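(* Let $g$ be an $\omega$-Lie superalgebra over a field $\mathbb{K}$ of characteristic zero. If $\mathrm{Z}(g)=\{0\}$, then $$\mathrm{C}^{\omega}(g)=\mathrm{QDer}^{\omega}(g)\cap \mathrm{QC}^{\omega}(g).$$
   Context: $\mathbb{K}$ is a field of characteristic zero. An $\omega$-Lie superalgebra is a $\mathbb{Z}_2$-graded $\mathbb{K}$-vector space $g=g_{\bar 0}\oplus g_{\bar 1}$ with a bilinear bracket $[\cdot,\cdot]:g\times g\to g$ and a bilinear form $\omega:g\times g\to\mathbb{K}$ such that, for all $\alpha,\beta\in\mathbb{Z}_2$ and all homogeneous $x,y,z\in g$ (with $|x|\in\mathbb{Z}_2$ the degree of $x$): (1) $[g_\alpha,g_\beta]\subseteq g_{\alpha+\beta}$; (2) $[x,y]=-(-1)^{|x||y|}[y,x]$; (3) $(-1)^{|x||y|}[[y,z],x]+(-1)^{|y||z|}[[z,x],y]+(-1)^{|x||z|}[[x,y],z]=(-1)^{|x||y|}\omega(y,z)x+(-1)^{|y||z|}\omega(z,x)y+(-1)^{|x||z|}\omega(x,y)z$; (4) $\omega(g_{\bar 0},g_{\bar 1})=0$. The center is $\mathrm{Z}(g)=\{x\in g:[x,y]=0\ \text{for all } y\in g\}$. $\mathrm{End}(g)$ is the space of linear endomorphisms with its $\mathbb{Z}_2$-grading; $|d|$ is the degree of a homogeneous $d$. All conditions below are for homogeneous $x\in g$ and all $y\in g$. A homogeneous linear map $d$ is: - a quasiderivation if there is a linear map $d'$ homogeneous of degree $|d|$ with $d'([x,y])=[d(x),y]+(-1)^{|d||x|}[x,d(y)]$;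 - in the centroid if $[d(x),y]=(-1)^{|d||x|}[x,d(y)]=d([x,y])$; - in the quasicentroid if $[d(x),y]=(-1)^{|d||x|}[x,d(y)]$; - compatible if $\omega(d(x),y)+(-1)^{|d||x|}\omega(x,d(y))=0$. $\mathrm{QDer}^{\omega}(g)$, $\mathrm{C}^{\omega}(g)$, $\mathrm{QC}^{\omega}(g)$ denote the graded subspaces of $\mathrm{End}(g)$ spanned by the compatible homogeneous quasiderivations, compatible homogeneous elements of the centroid, and compatible homogeneous elements of the quasicentroid, respectively. *)

theory Defs
  imports Complex_Main "HOL-Library.Z2" "HOL-Library.Function_Algebras"
begin

text \<open>
  Degrees live in \<open>\<int>/2\<close>, represented by the two-element field \<^typ>\<open>bit\<close>, so that
  \<open>|x| |y|\<close> is the product in \<^typ>\<open>bit\<close>. \<open>ksign e\<close> is the scalar \<open>(-1)\<^sup>e\<close>.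
\<close>

definition ksign :: "bit \<Rightarrow> 'k::ring_1" where
  "ksign e = (if e = 1 then - 1 else 1)"

text \<open>
  The underlying space is the whole type \<open>'g\<close> with scalar multiplication \<open>scale\<close>, of arbitrary
  dimension; \<open>G 0\<close> and \<open>G 1\<close> are the even and odd parts. Homogeneous elements are the members
  of \<open>G a\<close>; the zero vector belongs to both parts. The form \<open>\<omega>\<close> is only required to vanish on
  \<open>G 0 \<times> G 1\<close>, and no symmetry of \<open>\<omega>\<close> is assumed.
\<close>

locale omega_lie_superalgebra = vector_space scale
  for scale :: "'k::field_char_0 \<Rightarrow> 'g::ab_group_add \<Rightarrow> 'g" (infixr \<open>*s\<close> 75) +
  fixes G :: "bit \<Rightarrow> 'g set"
    and br :: "'g \<Rightarrow> 'g \<Rightarrow> 'g"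
    and \<omega> :: "'g \<Rightarrow> 'g \<Rightarrow> 'k"
  assumes subspace_G: "subspace (G a)"
    and G_sum: "\<exists>u\<in>G 0. \<exists>v\<in>G 1. x = u + v"
    and G_inter: "G 0 \<inter> G 1 = {0}"
    and br_linear_right: "Vector_Spaces.linear scale scale (\<lambda>y. br x y)"
    and br_linear_left: "Vector_Spaces.linear scale scale (\<lambda>x. br x y)"
    and omega_linear_right: "Vector_Spaces.linear scale (*) (\<lambda>y. \<omega> x y)"
    and omega_linear_left: "Vector_Spaces.linear scale (*) (\<lambda>x. \<omega> x y)"
    and br_graded: "\<lbrakk>x \<in> G a; y \<in> G b\<rbrakk> \<Longrightarrow> br x y \<in> G (a + b)"
    and br_skew: "\<lbrakk>x \<in> G a; y \<in> G b\<rbrakk> \<Longrightarrow> br x y = - (ksign (a * b) *s br y x)"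
    and omega_jacobi: "\<lbrakk>x \<in> G a; y \<in> G b; z \<in> G c\<rbrakk> \<Longrightarrow>
          ksign (a * b) *s br (br y z) x
        + ksign (b * c) *s br (br z x) y
        + ksign (a * c) *s br (br x y) z
        = ksign (a * b) *s \<omega> y z *s x
        + ksign (b * c) *s \<omega> z x *s y
        + ksign (a * c) *s \<omega> x y *s z"
    and omega_even_odd: "\<lbrakk>x \<in> G 0; y \<in> G 1\<rbrakk> \<Longrightarrow> \<omega> x y = 0"
begin

definition center :: "'g set" where
  "center = {x. \<forall>y. br x y = 0}"

definition homogeneous_map :: "bit \<Rightarrow> ('g \<Rightarrow> 'g) \<Rightarrow> bool" where
  "homogeneous_map a d \<longleftrightarrow>
     Vector_Spaces.linear scale scale d \<and> (\<forall>b. \<forall>x\<in>G b. d x \<in> G (a + b))"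

definition compatible :: "bit \<Rightarrow> ('g \<Rightarrow> 'g) \<Rightarrow> bool" where
  "compatible a d \<longleftrightarrow>
     (\<forall>b. \<forall>x\<in>G b. \<forall>y. \<omega> (d x) y + ksign (a * b) * \<omega> x (d y) = 0)"

definition quasiderivation :: "bit \<Rightarrow> ('g \<Rightarrow> 'g) \<Rightarrow> bool" where
  "quasiderivation a d \<longleftrightarrow> homogeneous_map a d \<and>
     (\<exists>d'. homogeneous_map a d' \<and>
        (\<forall>b. \<forall>x\<in>G b. \<forall>y. d' (br x y) = br (d x) y + ksign (a * b) *s br x (d y)))"

definition in_centroid :: "bit \<Rightarrow> ('g \<Rightarrow> 'g) \<Rightarrow> bool" where
  "in_centroid a d \<longleftrightarrow> homogeneous_map a d \<and>
     (\<forall>b. \<forall>x\<in>G b. \<forall>y. br (d x) y = ksign (a * b) *s br x (d y) \<and>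
                      ksign (a * b) *s br x (d y) = d (br x y))"

definition in_quasicentroid :: "bit \<Rightarrow> ('g \<Rightarrow> 'g) \<Rightarrow> bool" where
  "in_quasicentroid a d \<longleftrightarrow> homogeneous_map a d \<and>
     (\<forall>b. \<forall>x\<in>G b. \<forall>y. br (d x) y = ksign (a * b) *s br x (d y))"

text \<open>
  Linear span in the space of all maps \<open>'g \<Rightarrow> 'g\<close> with pointwise operations; the span of a set
  of linear maps is the same there as in \<open>End(g)\<close>.
\<close>

definition map_scale :: "'k \<Rightarrow> ('g \<Rightarrow> 'g) \<Rightarrow> 'g \<Rightarrow> 'g" where
  "map_scale c f = (\<lambda>x. c *s f x)"

definition QDer_omega :: "('g \<Rightarrow> 'g) set" where
  "QDer_omega = module.span map_scale {d. \<exists>a. quasiderivation a d \<and> compatible a d}"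

definition C_omega :: "('g \<Rightarrow> 'g) set" where
  "C_omega = module.span map_scale {d. \<exists>a. in_centroid a d \<and> compatible a d}"

definition QC_omega :: "('g \<Rightarrow> 'g) set" where
  "QC_omega = module.span map_scale {d. \<exists>a. in_quasicentroid a d \<and> compatible a d}"

lemma vector_space_map_scale: "vector_space map_scale"
  by unfold_locales
    (simp_all add: map_scale_def fun_eq_iff scale_right_distrib scale_left_distrib)

end

end

theory Submission
  imports Defs
begin

text \<open>
  Since \<open>QDer\<close> and \<open>QC\<close> are graded, it suffices to treat a homogeneous compatible \<open>d\<close> lying
  in both. If \<open>\<omega> = 0\<close>, comparing the Jacobi identities of \<open>(dx, y, z)\<close>, \<open>(x, dy, z)\<close> and
  \<open>(x, y, dz)\<close> with \<open>d'\<close> applied to that of \<open>(x, y, z)\<close> shows that \<open>d[x, y] - [dx, y]\<close> is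
  central.

  If \<open>\<omega> \<noteq> 0\<close>, then \<open>d = 0\<close>. The Jacobi identity and the trivial center force \<open>\<omega>\<close> to
  be alternating on the even part and to vanish on all other pairs, so there are even \<open>a\<close>, \<open>b\<close>
  with \<open>\<omega>(a, b) = 1\<close>. An element in the radical of \<open>\<omega>\<close> killed by the even part is \<open>0\<close>, and
  for even \<open>z\<close> orthogonal to \<open>a\<close>, \<open>b\<close> and \<open>t\<close> in the radical, \<open>[z, t]\<close> is a combination
  of \<open>z\<close> and \<open>t\<close>. This yields \<open>d = 0\<close> when \<open>d\<close> is odd, and also when \<open>d\<close> is even with
  values in the radical, because then \<open>d\<^sup>2 = 0\<close>. An even \<open>d\<close> with
  \<open>\<omega>(da, a) \<noteq> 0\<close> for some even \<open>a\<close> is impossible: the action of \<open>a\<close> and \<open>b = da\<close>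
  on the orthogonal complement of \<open>a\<close>, \<open>b\<close> shows that this complement is \<open>0\<close>, so the
  algebra is spanned by the commuting elements \<open>a\<close> and \<open>b\<close>.
\<close>

section \<open>Signs, bilinearity and the grading\<close>

lemma ksign_simps [simp]: "ksign 0 = 1" "ksign 1 = - 1"
  by (simp_all add: ksign_def)

lemma ksign_distrib:
  "ksign ((a + b) * c) = ksign (a * c) * (ksign (b * c) :: 'k::ring_1)"
  "ksign (c * (a + b)) = ksign (c * a) * (ksign (c * b) :: 'k::ring_1)"
  by (cases a; cases b; cases c; simp)+

lemma ksign_mult_self [simp]: "ksign a * ksign a = (1 :: 'k::ring_1)"
  by (cases a) simp_all

context omega_lie_superalgebra
begin

sublocale br_right: module_hom scale scale "br x" for x
  using br_linear_right[of x] by (simp add: linear_iff_module_hom)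

sublocale br_left: module_hom scale scale "\<lambda>x. br x y" for y
  using br_linear_left[of y] by (simp add: linear_iff_module_hom)

sublocale omega_right: module_hom scale "(*)" "\<omega> x" for x
  using omega_linear_right[of x] by (simp add: linear_iff_module_hom)

sublocale omega_left: module_hom scale "(*)" "\<lambda>x. \<omega> x y" for y
  using omega_linear_left[of y] by (simp add: linear_iff_module_hom)

lemmas bilinear =
  br_right.add br_right.scale br_right.diff br_right.neg
  br_left.add br_left.scale br_left.diff br_left.neg
  omega_right.add omega_right.scale omega_right.diff omega_right.neg
  omega_left.add omega_left.scale omega_left.diff omega_left.neg

lemmas scale_rules = scale_right_distrib scale_left_distrib
  scale_right_diff_distrib scale_left_diff_distrib

lemma zero_simps [simp]: "br x 0 = 0" "br 0 x = 0" "\<omega> x 0 = 0" "\<omega> 0 x = 0"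
  by (rule br_right.zero br_left.zero omega_right.zero omega_left.zero)+

lemma numeral_scale:
  "2 *s x = x + x" "3 *s x = x + x + x" "4 *s x = x + x + x + x"
proof -
  show *: "2 *s x = x + x" for x
    using scale_left_distrib[of "1::'k" 1 x] by simp
  show "3 *s x = x + x + x"
    using scale_left_distrib[of "2::'k" 1 x] by (simp add: *)
  show "4 *s x = x + x + x + x"
    using scale_left_distrib[of "2::'k" 2 x] by (simp add: * add.assoc)
qed

lemma trivial_centerD:
  assumes "center = {0}" "\<And>y. br x y = 0"
  shows "x = 0"
proof -
  have "x \<in> center" using assms(2) by (simp add: center_def)
  then show ?thesis using assms(1) by simp
qed

lemma add_self_eq_0: "(x::'g) + x = 0 \<Longrightarrow> x = 0"
proof -
  assume "x + x = 0"
  then have "(2::'k) *s x = 0"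
    by (metis one_add_one scale_left_distrib scale_one)
  then show "x = 0" by simp
qed

lemma eq_minus_self: "(x::'g) = - x \<Longrightarrow> x = 0"
  by (metis add_self_eq_0 add.right_inverse)

lemmas G_closed = subspace_add[OF subspace_G] subspace_diff[OF subspace_G]
  subspace_scale[OF subspace_G] subspace_neg[OF subspace_G]

lemma br_G0 [intro]: "x \<in> G 0 \<Longrightarrow> y \<in> G b \<Longrightarrow> br x y \<in> G b"
  using br_graded[of x 0 y b] by (metis add_0)

lemma G_decomp:
  obtains u v where "u \<in> G 0" "v \<in> G 1" "x = u + v"
  using G_sum by blast

section \<open>The form on even and odd vectors\<close>

lemma br_even_skew: "x \<in> G 0 \<Longrightarrow> br t x = - br x t"
  using br_skew[of _ 0 x] br_skew[of _ 1 x]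
  by (rule_tac x = t in G_decomp) (force simp: bilinear)

lemma br_even_self: "x \<in> G 0 \<Longrightarrow> br x x = 0"
  using br_even_skew eq_minus_self by blast

text \<open>The Jacobi identity at \<open>x\<close>, \<open>x\<close>, \<open>x\<close> leaves three
  times \<open>\<omega> x x *s x\<close> equal to 0.\<close>

lemma omega_even_self: assumes "x \<in> G 0" shows "\<omega> x x = 0"
proof -
  have "\<omega> x x *s x + \<omega> x x *s x + \<omega> x x *s x = 0"
    using omega_jacobi[OF assms assms assms] by (simp add: br_even_self[OF assms])
  then have "(3 * \<omega> x x) *s x = 0"
    by (simp add: scale_left_distrib[symmetric])
  then show ?thesis by auto
qed

text \<open>In the Jacobi identity at \<open>z\<close>, \<open>z\<close>, \<open>x\<close> the
  brackets cancel, which leaves a multiple of \<open>z\<close>.\<close>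

lemma omega_odd_even: assumes "x \<in> G 1" "z \<in> G 0" shows "\<omega> x z = 0"
proof -
  have "\<omega> z x = 0" by (rule omega_even_odd[OF assms(2,1)])
  moreover have "br x z = - br z x" by (rule br_even_skew[OF assms(2)])
  ultimately have "\<omega> x z *s z = 0"
    using omega_jacobi[OF assms(2) assms(2) assms(1)]
    by (simp add: br_even_self omega_even_self assms bilinear)
  then show ?thesis by auto
qed

lemma omega_even_skew: assumes "x \<in> G 0" shows "\<omega> t x = - \<omega> x t"
proof -
  obtain u v where t: "u \<in> G 0" "v \<in> G 1" "t = u + v" by (rule G_decomp)
  have "\<omega> (u + x) (u + x) = 0"
    using omega_even_self G_closed(1) assms t by blast
  then have "\<omega> u x + \<omega> x u = 0"
    using omega_even_self assms t by (simp add: bilinear add.commute)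
  then show ?thesis
    using t assms omega_odd_even omega_even_odd
    by (simp add: bilinear eq_neg_iff_add_eq_0)
qed

text \<open>From here on an even element acts on the whole space, so no signs occur.\<close>

lemma jacobi_even:
  assumes x: "x \<in> G 0" and y: "y \<in> G 0"
  shows "br (br x y) t = br x (br y t) - br y (br x t) + \<omega> x y *s t + \<omega> y t *s x - \<omega> x t *s y"
proof -
  have *: "br (br x y) t = br x (br y t) - br y (br x t) + \<omega> x y *s t + \<omega> y t *s x - \<omega> x t *s y"
    if t: "t \<in> G b" for t b
    using omega_jacobi[OF x y t] br_even_skew[OF x, of "br y t"] br_even_skew[OF x, of t]
      br_even_skew[OF y, of "br x t"] omega_even_skew[OF x, of t]
    by (simp add: bilinear algebra_simps)
  obtain u v where t: "u \<in> G 0" "v \<in> G 1" "t = u + v" by (rule G_decomp)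
  show ?thesis
    by (simp add: t(3) bilinear scale_rules *[OF t(1)] *[OF t(2)])
qed

text \<open>The Jacobi identities for \<open>x\<close>, \<open>y\<close>, \<open>z\<close> and
  \<open>y\<close>, \<open>x\<close>, \<open>z\<close>, read as coefficients of \<open>z\<close>,
  make \<omega> symmetric on odd vectors, while \<open>self\<close> makes it alternating.\<close>

lemma omega_odd_odd:
  assumes x: "x \<in> G 1" and y: "y \<in> G 1" and z: "z \<in> G 0" "z \<noteq> 0"
  shows "\<omega> x y = 0"
proof -
  have self: "\<omega> x x = 0" if x: "x \<in> G 1" for x
  proof (rule ccontr)
    assume nz: "\<omega> x x \<noteq> 0"
    define c where "c = br x x"
    have c: "c \<in> G 0" using br_graded[OF x x] by (simp add: c_def)
    have "br c x + br c x + br c x = \<omega> x x *s x + \<omega> x x *s x + \<omega> x x *s x"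
      using omega_jacobi[OF x x x] by (simp add: c_def algebra_simps)
    then have "(1 + 1 + 1) *s br c x = (1 + 1 + 1) *s (\<omega> x x *s x)"
      by (simp only: scale_left_distrib scale_one)
    then have "(3::'k) *s br c x = (3::'k) *s (\<omega> x x *s x)" by simp
    then have cx: "br c x = \<omega> x x *s x" by (metis scale_cancel_left zero_neq_numeral)
    \<comment> \<open>Inserting \<open>cx\<close> into the Jacobi identity at \<open>x\<close>,
      \<open>x\<close>, \<open>c\<close> doubles one side only.\<close>
    have "\<omega> x x *s c + \<omega> x x *s c = \<omega> x x *s c"
      using omega_jacobi[OF x x c] br_even_skew[OF c, of x] br_even_self[OF c]
        omega_odd_even[OF x c] omega_even_odd[OF c x] cx
      by (simp add: bilinear c_def[symmetric])
    then have "c = 0" using nz by simp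
    then have "\<omega> x x *s x = 0" using cx by simp
    then show False using nz by auto
  qed
  have "\<omega> (x + y) (x + y) = 0" using self G_closed(1) x y by blast
  then have "\<omega> x y + \<omega> y x = 0" using self[OF x] self[OF y]
    by (simp add: bilinear add.commute)
  moreover have "\<omega> x y *s z = \<omega> y x *s z"
    using omega_jacobi[OF x y z(1)] omega_jacobi[OF y x z(1)] br_even_skew[OF z(1), of x]
      br_even_skew[OF z(1), of y] br_skew[OF x y] omega_odd_even[OF x z(1)]
      omega_odd_even[OF y z(1)] omega_even_odd[OF z(1) x] omega_even_odd[OF z(1) y]
    by (simp add: bilinear algebra_simps)
  ultimately show ?thesis using z(2)
    by (metis add_self_eq_0 scale_cancel_right scale_eq_0_iff scale_left_distrib)
qed

section \<open>Action of even elements on the radical\<close>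

definition omega_cyclic :: "'g \<Rightarrow> 'g \<Rightarrow> 'g \<Rightarrow> 'k" where
  "omega_cyclic x y z = \<omega> (br x y) z + \<omega> (br y z) x + \<omega> (br z x) y"

text \<open>Both sides of the Jacobi identity for \<open>x\<close>, \<open>y\<close>,
  \<open>z\<close> act on \<open>t\<close>. The threefold nested brackets cancel in the cyclic sum.
  Up to sign, \<open>omega_cyclic\<close> is the Chevalley-Eilenberg coboundary of \<omega>.\<close>

lemma radical_identity:
  assumes x: "x \<in> G 0" and y: "y \<in> G 0" and z: "z \<in> G 0"
    and t: "\<And>s. s \<in> G 0 \<Longrightarrow> \<omega> s t = 0"
  shows "\<omega> x y *s br z t + \<omega> y z *s br x t + \<omega> z x *s br y t
    = omega_cyclic x y z *s t
      + (\<omega> y (br z t) *s x - \<omega> x (br z t) *s y)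
      + (\<omega> z (br x t) *s y - \<omega> y (br x t) *s z)
      + (\<omega> x (br y t) *s z - \<omega> z (br y t) *s x)"
proof -
  have nest: "br (br (br x y) z) t = \<omega> (br x y) z *s t
      + (br x (br y (br z t)) - br y (br x (br z t)))
      - (br z (br x (br y t)) - br z (br y (br x t)))
      + (\<omega> y (br z t) *s x - \<omega> x (br z t) *s y)"
    if xyz: "x \<in> G 0" "y \<in> G 0" "z \<in> G 0" for x y z
  proof -
    have xy: "br x y \<in> G 0" using xyz by blast
    show ?thesis
      unfolding jacobi_even[OF xy xyz(3), of t]
      by (simp add: jacobi_even[OF xyz(1,2)] t xyz xy bilinear algebra_simps)
  qed
  have "br (br (br x y) z + br (br y z) x + br (br z x) y) t
      = br (\<omega> x y *s z + \<omega> y z *s x + \<omega> z x *s y) t"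
    using omega_jacobi[OF x y z] by (simp add: algebra_simps)
  then show ?thesis
    using nest[OF x y z] nest[OF y z x] nest[OF z x y]
    by (simp add: bilinear omega_cyclic_def algebra_simps)
qed

context
  fixes a b :: 'g
  assumes a: "a \<in> G 0" and b: "b \<in> G 0" and ab: "\<omega> a b = 1"
begin

lemma omega_swap: "\<omega> b a = - 1"
  using omega_even_skew[OF a, of b] ab by simp

lemma hyperbolic_decomp:
  assumes "x \<in> G 0"
  obtains x' where "x' \<in> G 0" "\<omega> a x' = 0" "\<omega> b x' = 0"
    "x = \<omega> x b *s a + \<omega> a x *s b + x'"
proof
  let ?x' = "x - \<omega> x b *s a - \<omega> a x *s b"
  show "?x' \<in> G 0" using assms a b by (intro G_closed)
  show "\<omega> a ?x' = 0" using omega_even_self a ab by (simp add: bilinear)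
  show "\<omega> b ?x' = 0" using omega_even_self b omega_even_skew[OF b, of x] omega_swap
    by (simp add: bilinear)
qed simp

text \<open>In the Jacobi identity for \<open>a\<close>, \<open>b\<close>, \<open>d\<close>
  everything vanishes except \<open>\<omega> a b *s d\<close>, which is \<open>d\<close>.\<close>

lemma ad_faithful_off_radical:
  assumes "\<And>x. x \<in> G 0 \<Longrightarrow> br x d = 0" "\<omega> a d = 0" "\<omega> b d = 0"
  shows "d = 0"
  using jacobi_even[OF a b, of d] assms a b br_G0[OF a b] ab by simp

lemma perp_radical:
  assumes z: "z \<in> G 0" "\<omega> a z = 0" "\<omega> b z = 0"
    and t: "\<And>s. s \<in> G 0 \<Longrightarrow> \<omega> s t = 0"
  shows "br z t = omega_cyclic a b z *s t + (\<omega> a (br b t) - \<omega> b (br a t)) *s z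
      + (\<omega> b (br z t) - \<omega> z (br b t)) *s a + (\<omega> z (br a t) - \<omega> a (br z t)) *s b"
proof -
  have "\<omega> z a = 0" using omega_even_skew[OF a, of z] z by simp
  then show ?thesis
    using radical_identity[OF a b z(1) t] z ab by (simp add: algebra_simps)
qed

text \<open>Pairing the expansion of \<open>br z t\<close> with \<open>a\<close> or \<open>b\<close>
  kills all but one of its four summands.\<close>

lemma perp_radical_omega:
  assumes z: "z \<in> G 0" "\<omega> a z = 0" "\<omega> b z = 0"
    and t: "\<And>s. s \<in> G 0 \<Longrightarrow> \<omega> s t = 0"
  shows "2 * \<omega> a (br z t) = \<omega> z (br a t)" and "2 * \<omega> b (br z t) = \<omega> z (br b t)"
proof -
  have "\<omega> a (br z t) = \<omega> z (br a t) - \<omega> a (br z t)"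
    by (subst perp_radical[OF z t])
      (simp_all add: bilinear t a b z ab omega_even_self)
  then show "2 * \<omega> a (br z t) = \<omega> z (br a t)" by simp
  have "\<omega> b (br z t) = - (\<omega> b (br z t) - \<omega> z (br b t))"
    by (subst perp_radical[OF z t])
      (simp_all add: bilinear t a b z omega_swap omega_even_self)
  then show "2 * \<omega> b (br z t) = \<omega> z (br b t)" by simp
qed

end

text \<open>If \<open>z\<close> is not in the radical, then \<open>z\<close> and \<open>a\<close>, \<open>b\<close> may exchange their roles in
  the factor 2 of the preceding lemma.\<close>

lemma perp_radical_omega_0:
  assumes a: "a \<in> G 0" and b: "b \<in> G 0" and ab: "\<omega> a b = 1"
    and z: "z \<in> G 0" "\<omega> a z = 0" "\<omega> b z = 0"
    and t: "\<And>s. s \<in> G 0 \<Longrightarrow> \<omega> s t = 0"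
  shows "\<omega> a (br z t) = 0 \<and> \<omega> b (br z t) = 0 \<and> \<omega> z (br a t) = 0 \<and> \<omega> z (br b t) = 0"
proof -
  note two = perp_radical_omega[OF a b ab z t]
  have *: "\<omega> z (br a t) = 0 \<and> \<omega> z (br b t) = 0"
  proof (cases "\<forall>y\<in>G 0. \<omega> z y = 0")
    case True
    have "\<omega> z y = 0" for y
      by (rule G_decomp[of y]) (use True omega_even_odd[OF z(1)] in \<open>auto simp: bilinear\<close>)
    then show ?thesis by simp
  next
    case False
    then obtain y where y: "y \<in> G 0" "\<omega> z y \<noteq> 0" by blast
    obtain y' where y': "y' \<in> G 0" "\<omega> a y' = 0" "\<omega> b y' = 0"
      "y = \<omega> y b *s a + \<omega> a y *s b + y'"
      by (rule hyperbolic_decomp[OF a b ab y(1)])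
    have za: "\<omega> z a = 0" "\<omega> z b = 0"
      using omega_even_skew[OF a, of z] omega_even_skew[OF b, of z] z by simp_all
    have "\<omega> z y = \<omega> z y'" by (subst y'(4)) (simp add: bilinear za)
    \<comment> \<open>Projecting \<open>y\<close> off the plane of \<open>a\<close>,
      \<open>b\<close> and rescaling gives a partner of \<open>z\<close> orthogonal to
      \<open>a\<close> and \<open>b\<close>.\<close>
    define v where "v = inverse (\<omega> z y) *s y'"
    have v: "v \<in> G 0" "\<omega> z v = 1"
      using y' y \<open>\<omega> z y = \<omega> z y'\<close> G_closed(3) by (auto simp: v_def bilinear)
    have va: "\<omega> v a = 0" "\<omega> v b = 0"
      using omega_even_skew[OF a, of v] omega_even_skew[OF b, of v] y'
      by (simp_all add: v_def bilinear)
    \<comment> \<open>The pairs \<open>a\<close>, \<open>b\<close> and \<open>z\<close>,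
      \<open>v\<close> give each of two numbers as twice the other, hence as four times
      itself.\<close>
    have quarter: "p = 0" if "2 * p = q" "2 * q = p" for p q :: 'k
    proof -
      have "4 * p = 2 * (2 * p)" by simp
      also have "\<dots> = p" by (simp only: that)
      finally show ?thesis by simp
    qed
    have "\<omega> z (br a t) = 0"
      by (rule quarter[OF perp_radical_omega(1)[OF z(1) v a za(1) va(1) t] two(1)])
    moreover have "\<omega> z (br b t) = 0"
      by (rule quarter[OF perp_radical_omega(1)[OF z(1) v b za(2) va(2) t] two(2)])
    ultimately show ?thesis by simp
  qed
  then show ?thesis using two by simp
qed

lemma perp_radical_0:
  assumes a: "a \<in> G 0" and b: "b \<in> G 0" and ab: "\<omega> a b = 1"
    and z: "z \<in> G 0" "\<omega> a z = 0" "\<omega> b z = 0"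
    and t: "\<And>s. s \<in> G 0 \<Longrightarrow> \<omega> s t = 0"
  shows "br z t = omega_cyclic a b z *s t + (\<omega> a (br b t) - \<omega> b (br a t)) *s z"
  using perp_radical[OF a b ab z t] perp_radical_omega_0[OF a b ab z t] by simp

section \<open>Maps with values in the radical\<close>

text \<open>The last hypothesis is the only place where the parity of \<open>D\<close> matters: its first
  alternative is used for even \<open>D\<close>, the second one holds for odd \<open>D\<close> by degree reasons.\<close>

lemma radical_valued_eq_0_even:
  assumes lin: "Vector_Spaces.linear scale scale D"
    and a: "a \<in> G 0" and b: "b \<in> G 0" and ab: "\<omega> a b = 1"
    and qc: "\<And>x y. x \<in> G 0 \<Longrightarrow> y \<in> G 0 \<Longrightarrow> br (D x) y = br x (D y)"
    and rad: "\<And>x y. x \<in> G 0 \<Longrightarrow> y \<in> G 0 \<Longrightarrow> \<omega> x (D y) = 0"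
    and H: "(\<forall>x\<in>G 0. \<forall>y\<in>G 0. D x \<in> G 0 \<and> D (D x) = 0 \<and> D (br (D x) y) = 0) \<or>
      (\<forall>x\<in>G 0. \<forall>y\<in>G 0. \<forall>z\<in>G 0. \<omega> x (br y (D z)) = 0)"
    and x: "x \<in> G 0"
  shows "D x = 0"
proof -
  interpret D: module_hom scale scale D
    using lin by (simp add: linear_iff_module_hom)
  note D_simps = D.add D.scale D.diff D.neg
  have qc': "br x (D y) = - br y (D x)" if "x \<in> G 0" "y \<in> G 0" for x y
    using qc[OF that] br_even_skew[OF that(2), of "D x"] by simp
  have self: "br x (D x) = 0" if "x \<in> G 0" for x
    using qc'[OF that that] eq_minus_self by blast
  \<comment> \<open>The coefficient of \<open>z\<close> in \<open>perp_radical_0\<close>.\<close>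
  define sg where "sg t = \<omega> a (br b t) - \<omega> b (br a t)" for t
  have perp: "D z = 0" if z: "z \<in> G 0" "\<omega> a z = 0" "\<omega> b z = 0" for z
  proof (rule ccontr)
    assume nz: "D z \<noteq> 0"
    have f: "br z (D x) = omega_cyclic a b z *s D x + sg (D x) *s z" if "x \<in> G 0" for x
      unfolding sg_def by (rule perp_radical_0[OF a b ab z rad[OF _ that]])
    have sg: "sg (D x) = 0" if x: "x \<in> G 0" for x
      using H
    proof
      assume H1: "\<forall>x\<in>G 0. \<forall>y\<in>G 0. D x \<in> G 0 \<and> D (D x) = 0 \<and> D (br (D x) y) = 0"
      then have "D (br z (D x)) = 0" using qc[OF z(1) x] z x by metis
      then have "sg (D x) *s D z = 0" using f[OF x] H1 x by (simp add: D_simps)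
      then show ?thesis using nz by simp
    qed (use a b x in \<open>simp add: sg_def\<close>)
    \<comment> \<open>Take \<open>x = z\<close> in \<open>f\<close>, where the bracket vanishes by
      \<open>self\<close>.\<close>
    have "omega_cyclic a b z = 0" using f[OF z(1)] sg[OF z(1)] self[OF z(1)] nz by simp
    then have "br x (D z) = 0" if "x \<in> G 0" for x
      using f[OF that] sg[OF that] qc'[OF that z(1)] by simp
    then show False
      using ad_faithful_off_radical[OF a b ab, of "D z"] rad a b z nz by blast
  qed
  define u v w c where "u = D a" and "v = D b" and "w = br a v" and "c = br a b"
  have au: "br a u = 0" and bv: "br b v = 0" using self a b by (simp_all add: u_def v_def)
  have bu: "br b u = - w" using qc'[OF b a] by (simp add: u_def v_def w_def)
  have zuv: "br z u = 0" "br z v = 0" if "z \<in> G 0" "\<omega> a z = 0" "\<omega> b z = 0" for z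
    using qc'[OF that(1) a] qc'[OF that(1) b] perp[OF that] by (simp_all add: u_def v_def)
  have c: "c \<in> G 0" using a b by (auto simp: c_def)
  define \<alpha> \<beta> where "\<alpha> = \<omega> c b" and "\<beta> = \<omega> a c"
  obtain c' where c': "c' \<in> G 0" "\<omega> a c' = 0" "\<omega> b c' = 0" "c = \<alpha> *s a + \<beta> *s b + c'"
    unfolding \<alpha>_def \<beta>_def by (rule hyperbolic_decomp[OF a b ab c])
  have rad_uv: "\<omega> x u = 0" "\<omega> x v = 0" if "x \<in> G 0" for x
    using rad that a b by (simp_all add: u_def v_def)
  \<comment> \<open>Compute \<open>br c u\<close> by the Jacobi identity for \<open>a\<close>,
    \<open>b\<close> and by the decomposition of \<open>c\<close>, whose part \<open>c'\<close>
    kills \<open>u\<close>; \<open>bw\<close> does the same with \<open>v\<close>.\<close>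
  have aw: "br a w = u + \<beta> *s w"
  proof -
    have "br c u = - br a w + u"
      using jacobi_even[OF a b, of u] rad_uv a b au bu ab
      by (simp add: bilinear c_def)
    moreover have "br c u = - (\<beta> *s w)"
      by (subst c'(4)) (simp add: bilinear au bu zuv c'(1-3))
    ultimately show ?thesis by (simp add: algebra_simps)
  qed
  have bw: "br b w = v - \<alpha> *s w"
  proof -
    have "br c v = - br b w + v"
      using jacobi_even[OF a b, of v] rad_uv a b bv ab
      by (simp add: bilinear c_def w_def)
    moreover have "br c v = \<alpha> *s w"
      by (subst c'(4)) (simp add: bilinear bv zuv c'(1-3) w_def[symmetric])
    ultimately show ?thesis by (simp add: algebra_simps)
  qed
  \<comment> \<open>In the first alternative this is \<open>D w = 0\<close>, read in the
    decomposition of \<open>w\<close>; in the second both coefficients vanish.\<close>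
  have uv: "\<omega> b w *s u = \<omega> a w *s v"
    using H
  proof
    assume H1: "\<forall>x\<in>G 0. \<forall>y\<in>G 0. D x \<in> G 0 \<and> D (D x) = 0 \<and> D (br (D x) y) = 0"
    have w: "w \<in> G 0" using H1 a b by (auto simp: w_def v_def)
    have "D w = 0" using H1 qc[OF a b] a b by (metis w_def v_def)
    moreover obtain w' where w': "w' \<in> G 0" "\<omega> a w' = 0" "\<omega> b w' = 0"
      "w = \<omega> w b *s a + \<omega> a w *s b + w'"
      by (rule hyperbolic_decomp[OF a b ab w])
    have "D w = \<omega> w b *s u + \<omega> a w *s v"
      by (subst w'(4)) (simp add: D_simps perp w'(1-3) u_def v_def)
    ultimately show ?thesis using omega_even_skew[OF b, of w] by simp
  qed (use a b in \<open>simp add: w_def v_def\<close>)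
  \<comment> \<open>Acting with \<open>b\<close> on \<open>uv\<close> kills \<open>v\<close> and
    turns \<open>u\<close> into \<open>- w\<close>; for \<open>aw0\<close>, acting with
    \<open>a\<close> kills \<open>u\<close> and turns \<open>v\<close> into
    \<open>w\<close>.\<close>
  have bw0: "\<omega> b w = 0"
  proof (rule ccontr)
    assume nz: "\<omega> b w \<noteq> 0"
    have "\<omega> b w *s br b u = 0"
      using arg_cong[OF uv, of "br b"] by (simp add: bilinear bv)
    then show False using nz bu by auto
  qed
  have aw0: "\<omega> a w = 0"
  proof (rule ccontr)
    assume nz: "\<omega> a w \<noteq> 0"
    have "\<omega> a w *s br a v = 0"
      using arg_cong[OF uv, of "br a"] by (simp add: bilinear au)
    then show False using nz w_def by auto
  qed
  have w_rad: "\<omega> x w = 0" if x: "x \<in> G 0" for x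
  proof -
    obtain x' where x': "x' \<in> G 0" "\<omega> a x' = 0" "\<omega> b x' = 0"
      "x = \<omega> x b *s a + \<omega> a x *s b + x'"
      by (rule hyperbolic_decomp[OF a b ab x])
    have "\<omega> x' w = 0"
      using perp_radical_omega_0[OF a b ab x'(1-3), of v] rad_uv by (simp add: w_def)
    then show ?thesis by (subst x'(4)) (simp add: bilinear aw0 bw0)
  qed
  have sg0: "sg u = 0" "sg v = 0" "sg w = 0"
    using a b rad_uv by (simp_all add: sg_def au bu bv aw bw aw0 bw0 bilinear w_def[symmetric])
  have c'_act: "br c' t = omega_cyclic a b c' *s t + sg t *s c'" if "\<And>s. s \<in> G 0 \<Longrightarrow> \<omega> s t = 0" for t
    unfolding sg_def by (rule perp_radical_0[OF a b ab c'(1-3) that])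
  have uv0: "u = 0 \<and> v = 0"
  proof (cases "omega_cyclic a b c' = 0")
    case False
    then show ?thesis
      using c'_act[OF rad_uv(1)] c'_act[OF rad_uv(2)] sg0 zuv[OF c'(1-3)] c'(1-3) by auto
  next
    case True
    then have c'w: "br c' w = 0" using c'_act[OF w_rad] sg0 by simp
    \<comment> \<open>Two computations of \<open>br c w\<close> express three times \<open>w\<close>
      by \<open>u\<close> and \<open>v\<close>; acting with \<open>a\<close> and \<open>b\<close>
      then expresses three times \<open>u\<close> and \<open>v\<close> by \<open>w\<close>.
      Substituted back, the terms cancel and nine times \<open>w\<close> is 0.\<close>
    have "br c w = w + w + w - \<alpha> *s u - \<beta> *s v"
      unfolding c_def jacobi_even[OF a b, of w]
      by (simp add: bilinear aw bw au bu bv aw0 bw0 ab w_def[symmetric] algebra_simps)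
    moreover have "br c w = \<alpha> *s u + \<beta> *s v"
      by (subst c'(4)) (simp add: bilinear aw bw c'w algebra_simps)
    ultimately have 3: "w + w + w = \<alpha> *s u + \<alpha> *s u + \<beta> *s v + \<beta> *s v"
      by (simp add: algebra_simps)
    have u3: "u + u + u = - (\<beta> *s w)"
      using arg_cong[OF 3, of "br a"]
      by (simp add: bilinear aw au w_def[symmetric] eq_neg_iff_add_eq_0 algebra_simps)
    have v3: "v + v + v = \<alpha> *s w"
      using arg_cong[OF 3, of "br b"]
      by (simp add: bilinear bw bu bv algebra_simps)
    have "(w + w + w) + (w + w + w) + (w + w + w)
        = \<alpha> *s (u + u + u) + \<alpha> *s (u + u + u) + \<beta> *s (v + v + v) + \<beta> *s (v + v + v)"
      unfolding 3 by (simp add: algebra_simps)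
    also have "\<dots> = 0" unfolding u3 v3 by (simp add: algebra_simps)
    finally have "3 *s (3 *s w) = 0" by (simp only: numeral_scale)
    then have "w = 0" by simp
    then show ?thesis using aw bw by simp
  qed
  obtain x' where x': "x' \<in> G 0" "\<omega> a x' = 0" "\<omega> b x' = 0"
    "x = \<omega> x b *s a + \<omega> a x *s b + x'"
    by (rule hyperbolic_decomp[OF a b ab x])
  have "D x = \<omega> x b *s u + \<omega> a x *s v + D x'"
    by (subst x'(4)) (simp add: D_simps u_def v_def)
  then show ?thesis using uv0 perp[OF x'(1-3)] by simp
qed

lemma radical_valued_eq_0:
  assumes lin: "Vector_Spaces.linear scale scale D"
    and a: "a \<in> G 0" and b: "b \<in> G 0" and ab: "\<omega> a b = 1"
    and qc: "\<And>x t. x \<in> G 0 \<Longrightarrow> br (D x) t = br x (D t)"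
    and rad: "\<And>x t. x \<in> G 0 \<Longrightarrow> \<omega> x (D t) = 0"
    and H: "(\<forall>x\<in>G 0. \<forall>y\<in>G 0. D x \<in> G 0 \<and> D (D x) = 0 \<and> D (br (D x) y) = 0) \<or>
      (\<forall>x\<in>G 0. \<forall>y\<in>G 0. \<forall>z\<in>G 0. \<omega> x (br y (D z)) = 0)"
  shows "D t = 0"
proof (rule ad_faithful_off_radical[OF a b ab])
  fix x assume x: "x \<in> G 0"
  have "D x = 0" by (rule radical_valued_eq_0_even[OF lin a b ab qc rad H x])
  then show "br x (D t) = 0" using qc[OF x, of t] by simp
qed (use rad a b in auto)

section \<open>Even maps and their defect from the centroid\<close>

context
  fixes D D' :: "'g \<Rightarrow> 'g"
  assumes lin: "Vector_Spaces.linear scale scale D" and lin': "Vector_Spaces.linear scale scale D'"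
    and D_even: "\<And>x. x \<in> G 0 \<Longrightarrow> D x \<in> G 0" and D'_even: "\<And>x. x \<in> G 0 \<Longrightarrow> D' x \<in> G 0"
    and qc: "\<And>x t. x \<in> G 0 \<Longrightarrow> br (D x) t = br x (D t)"
    and qd: "\<And>x t. x \<in> G 0 \<Longrightarrow> D' (br x t) = br x (D t) + br x (D t)"
    and compat: "\<And>x t. x \<in> G 0 \<Longrightarrow> \<omega> (D x) t = - \<omega> x (D t)"
begin

interpretation D: module_hom scale scale D
  using lin by (simp add: linear_iff_module_hom)

interpretation D': module_hom scale scale D'
  using lin' by (simp add: linear_iff_module_hom)

lemmas D_simps = D.add D.scale D.diff D.neg D'.add D'.scale D'.diff D'.neg

text \<open>In the centroid, twice \<open>D\<close> is a companion map. On \<open>br x t\<close>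
  with even \<open>x\<close> this is twice \<open>D (br x t) - br x (D t)\<close>.\<close>

definition defect :: "'g \<Rightarrow> 'g" where "defect x = D x + D x - D' x"

lemma defect_br: "x \<in> G 0 \<Longrightarrow> defect (br x t) = D (br x t) + D (br x t) - br x (D t) - br x (D t)"
  by (simp add: defect_def qd algebra_simps)

lemma defect_even: "x \<in> G 0 \<Longrightarrow> defect x \<in> G 0"
  unfolding defect_def by (intro G_closed D_even D'_even)

lemma br_D_self: assumes "x \<in> G 0" shows "br x (D x) = 0"
  using qc[OF assms, of x] br_even_skew[OF assms, of "D x"] eq_minus_self by metis

text \<open>Expand \<open>[[D x, y], z] = [[x, D y], z]\<close> and \<open>[[x, y], D z]\<close> by the Jacobi identity and
  compare with \<open>D'\<close> applied to the Jacobi identity for \<open>x\<close>, \<open>y\<close>, \<open>z\<close>.\<close>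

lemma defect_action:
  assumes x: "x \<in> G 0" and y: "y \<in> G 0"
  shows "2 *s br (defect (br x y)) z = 4 *s (\<omega> (D x) z *s y - \<omega> (D y) z *s x)
      + \<omega> x y *s (4 *s D z - defect z) - \<omega> y z *s defect x + \<omega> x z *s defect y"
proof -
  have xy: "br x y \<in> G 0" using x y by blast
  define N where "N = br (br x (D y)) z"
  define M where "M = br (br x y) (D z)"
  have 1: "N = br x (D (br y z)) - br y (br x (D z)) + \<omega> (D x) y *s z
      + \<omega> y z *s D x - \<omega> (D x) z *s y"
    using jacobi_even[OF D_even[OF x] y, of z] qc[OF x] by (simp add: N_def)
  have 2: "N = br x (br y (D z)) - br y (D (br x z)) + \<omega> x (D y) *s z
      + \<omega> (D y) z *s x - \<omega> x z *s D y"
    using jacobi_even[OF x D_even[OF y], of z] qc[OF y] by (simp add: N_def)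
  have 3: "M = br x (br y (D z)) - br y (br x (D z)) + \<omega> x y *s D z
      - \<omega> (D y) z *s x + \<omega> (D x) z *s y"
    using jacobi_even[OF x y, of "D z"] by (simp add: M_def compat x y bilinear)
  have 4: "M + M = br x (D (br y z)) + br x (D (br y z)) - br y (D (br x z)) - br y (D (br x z))
      + \<omega> x y *s D' z + \<omega> y z *s D' x - \<omega> x z *s D' y"
    using arg_cong[OF jacobi_even[OF x y, of z], of D']
    by (simp add: D_simps M_def qd x y xy)
  have 5: "br (defect (br x y)) z = M + M - N - N"
    unfolding defect_br[OF x] by (simp add: bilinear qc xy N_def M_def)
  have "2 *s br (defect (br x y)) z = (M + M) + M + M - N - N - N - N"
    unfolding 5 by (simp add: numeral_scale algebra_simps)
  \<comment> \<open>Two copies of \<open>M\<close> are kept together for \<open>4\<close>, the other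
    two use \<open>3\<close>; the four copies of \<open>N\<close> use \<open>1\<close> and
    \<open>2\<close> alternately. With this choice all nested brackets cancel.\<close>
  also have "\<dots> = (M + M) + M + M - (br x (D (br y z)) - br y (br x (D z)) + \<omega> (D x) y *s z
      + \<omega> y z *s D x - \<omega> (D x) z *s y) - (br x (br y (D z)) - br y (D (br x z)) + \<omega> x (D y) *s z
      + \<omega> (D y) z *s x - \<omega> x z *s D y)
      - (br x (D (br y z)) - br y (br x (D z)) + \<omega> (D x) y *s z
      + \<omega> y z *s D x - \<omega> (D x) z *s y) - (br x (br y (D z)) - br y (D (br x z)) + \<omega> x (D y) *s z
      + \<omega> (D y) z *s x - \<omega> x z *s D y)"
    using 1 2 by simp
  also have "\<dots> = 4 *s (\<omega> (D x) z *s y - \<omega> (D y) z *s x)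
      + \<omega> x y *s (4 *s D z - defect z) - \<omega> y z *s defect x + \<omega> x z *s defect y"
    unfolding 4 unfolding 3 numeral_scale defect_def
    by (simp add: compat x y algebra_simps)
  finally show ?thesis .
qed

text \<open>The relation \<open>br b t = br a (D t)\<close> ties the action of \<open>b\<close> to
  that of \<open>a\<close>; on \<open>V\<close> it gives \<open>br a (br b y)\<close>, for
  \<open>y = br b z\<close>, two values of opposite sign.\<close>

lemma even_isotropic:
  assumes center: "center = {0}" and a: "a \<in> G 0"
  shows "\<omega> (D a) a = 0"
proof (rule ccontr)
  assume "\<omega> (D a) a \<noteq> 0"
  define b where "b = D a"
  define r where "r = \<omega> a b"
  have b: "b \<in> G 0" using a D_even b_def by blast
  have r: "r \<noteq> 0"
    using \<open>\<omega> (D a) a \<noteq> 0\<close> compat[OF a, of a] by (simp add: r_def b_def)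
  have ba: "\<omega> b a = - r" using omega_even_skew[OF a, of b] by (simp add: r_def)
  have ab0: "br a b = 0" "br b a = 0"
    using br_D_self[OF a] br_even_skew[OF a, of b] by (simp_all add: b_def)
  have bt: "br b t = br a (D t)" for t using qc[OF a] by (simp add: b_def)
  have jac: "br b (br a t) - br a (br b t) = r *s t + \<omega> b t *s a - \<omega> a t *s b" for t
    using jacobi_even[OF a b, of t] ab0 by (simp add: r_def algebra_simps)
  define V where "V = {z. \<omega> a z = 0 \<and> \<omega> b z = 0}"
  have *: "br b z \<in> V \<and> br a (br b z) + br a (br b z) = r *s z \<and>
      br b (br b z) + br b (br b z) = (2 * \<omega> (D b) z) *s a - r *s D z" if "z \<in> V" for z
  proof -
    have z: "\<omega> a z = 0" "\<omega> b z = 0" using that by (simp_all add: V_def)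
    define \<nu> where "\<nu> = \<omega> (D b) z"
    \<comment> \<open>A preimage of \<open>r *s z\<close> under \<open>br a\<close>: this is
      \<open>jac\<close> at \<open>z\<close> with \<open>bt\<close> replacing the action of
      \<open>b\<close>.\<close>
    define q where "q = D (br a z) - br a (D z)"
    \<comment> \<open>As \<open>br a b = 0\<close>, the left side of \<open>defect_action\<close>
      vanishes, which determines \<open>D' z\<close>.\<close>
    have "r *s (4 *s D z - defect z) = 4 *s (\<nu> *s a)"
      using defect_action[OF a b, of z] z ab0
      by (simp add: defect_def D.zero D'.zero r_def \<nu>_def b_def[symmetric] algebra_simps)
    then have D'z: "r *s D' z = 4 *s (\<nu> *s a) - r *s D z - r *s D z"
      by (simp add: defect_def numeral_scale algebra_simps)
    have aq: "br a q = r *s z"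
      using jac[of z] z by (simp add: q_def bilinear bt)
    \<comment> \<open>Applying \<open>D'\<close> to \<open>aq\<close> converts the value of
      \<open>D' z\<close> into the action of \<open>b\<close> on \<open>q\<close>.\<close>
    have "br b q + br b q = r *s D' z"
      using arg_cong[OF aq, of D'] by (simp add: qd a D_simps bt)
    then have "2 *s br b q = 2 *s ((2 * \<nu>) *s a - r *s D z)"
      unfolding D'z by (simp add: numeral_scale algebra_simps flip: scale_scale)
    then have bq: "br b q = (2 * \<nu>) *s a - r *s D z" by (metis scale_cancel_left zero_neq_numeral)
    \<comment> \<open>Removing the components along \<open>a\<close> and \<open>b\<close> leaves
      both brackets unchanged, since \<open>a\<close> and \<open>b\<close> commute.\<close>
    define \<kappa> where "\<kappa> = q - (\<omega> q b / r) *s a - (\<omega> a q / r) *s b"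
    have \<kappa>: "\<kappa> \<in> V"
      using r omega_even_self[OF a] omega_even_self[OF b] ba omega_even_skew[OF b, of q]
      by (simp add: V_def \<kappa>_def bilinear r_def[symmetric])
    have a\<kappa>: "br a \<kappa> = r *s z" and b\<kappa>: "br b \<kappa> = (2 * \<nu>) *s a - r *s D z"
      using aq bq ab0 br_even_self[OF a] br_even_self[OF b] by (simp_all add: \<kappa>_def bilinear)
    have "r *s \<kappa> = r *s (br b z + br b z)"
      using jac[of \<kappa>] \<kappa> br_even_self[OF a]
      by (simp add: V_def a\<kappa> b\<kappa> bilinear bt[symmetric] algebra_simps)
    then have \<kappa>_eq: "\<kappa> = br b z + br b z" using r by simp
    have "br b z \<in> V"
    proof -
      have "br b z = (1 / 2) *s \<kappa>"
        by (simp add: \<kappa>_eq flip: numeral_scale)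
      then show ?thesis using \<kappa> by (simp add: V_def bilinear)
    qed
    then show ?thesis
      using a\<kappa> b\<kappa> unfolding \<kappa>_eq \<nu>_def by (simp add: bilinear)
  qed
  have V0: "z = 0" if z: "z \<in> V" for z
  proof -
    define y where "y = br b z"
    have y: "y \<in> V" "br b y \<in> V" using * z by (auto simp: y_def)
    have by_eq: "br b y + br b y = (2 * \<omega> (D b) z) *s a - r *s D z"
      using *[OF z] by (simp add: y_def)
    \<comment> \<open>This pairing is also 0, because \<open>br b y\<close> lies in
      \<open>V\<close>.\<close>
    have "\<omega> b (br b y + br b y) = - (r * \<omega> (D b) z)"
      unfolding by_eq by (simp add: bilinear ba compat[OF b])
    then have "\<omega> (D b) z = 0" using y(2) r by (simp add: V_def bilinear)
    then have "br b y + br b y = - (r *s D z)" using by_eq by simp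
    then have "br a (br b y) + br a (br b y) = - (r *s y)"
      by (metis bilinear(1,2,4) bt y_def)
    then have "r *s y = - (r *s y)" using *[OF y(1)] by simp
    then have "y = 0" using eq_minus_self r by fastforce
    then show "z = 0" using *[OF z] r by (simp add: y_def)
  qed
  have "br a t = 0" for t
  proof -
    have "t - (\<omega> t b / r) *s a - (\<omega> a t / r) *s b \<in> V"
      using r omega_even_self[OF a] omega_even_self[OF b] ba omega_even_skew[OF b, of t]
      by (simp add: V_def bilinear r_def[symmetric])
    then have "t = (\<omega> t b / r) *s a + (\<omega> a t / r) *s b"
      using V0 by (fastforce simp: algebra_simps)
    then show ?thesis
      using br_even_self[OF a] ab0 by (metis add.right_neutral bilinear(1,2) scale_zero_right)
  qed
  then have "a = 0" by (rule trivial_centerD[OF center])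
  then show False using \<open>\<omega> (D a) a \<noteq> 0\<close> by simp
qed

text \<open>On even vectors, polarizing \<open>even_isotropic\<close> makes
  \<open>\<omega> (D x) y\<close> antisymmetric in \<open>x\<close> and \<open>y\<close>, while
  compatibility makes it symmetric.\<close>

lemma even_radical_valued:
  assumes center: "center = {0}" and x: "x \<in> G 0"
  shows "\<omega> x (D t) = 0"
proof -
  have even: "\<omega> (D x) y = 0" if y: "y \<in> G 0" for y
  proof -
    have "\<omega> (D (x + y)) (x + y) = 0"
      using even_isotropic[OF center] G_closed(1) x y by blast
    then have "\<omega> (D x) y + \<omega> (D y) x = 0"
      using even_isotropic[OF center] x y by (simp add: D_simps bilinear add.commute)
    moreover have "\<omega> (D y) x = \<omega> (D x) y"
      using compat[OF y, of x] omega_even_skew[OF y, of "D x"] by simp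
    ultimately show ?thesis by simp
  qed
  obtain u v where t: "u \<in> G 0" "v \<in> G 1" "t = u + v" by (rule G_decomp)
  have "\<omega> (D x) t = 0"
    using even t omega_even_odd D_even[OF x] by (simp add: bilinear)
  then show ?thesis using compat[OF x] by simp
qed

text \<open>The aim is \<open>D (D x) = 0\<close> for even \<open>x\<close>, after which
  \<open>radical_valued_eq_0\<close> applies. The obstruction is the single element \<open>r\<close>
  below, which acts on even vectors as twice the square of \<open>D\<close>.\<close>

lemma even_eq_0:
  assumes center: "center = {0}"
    and a: "a \<in> G 0" and b: "b \<in> G 0" and ab: "\<omega> a b = 1"
  shows "D t = 0"
proof -
  note rad = even_radical_valued[OF center]
  have rad': "\<omega> (D x) t = 0" if "x \<in> G 0" for x t using rad compat that by simp
  have act: "2 *s br (defect (br x y)) z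
      = \<omega> x y *s (4 *s D z - defect z) - \<omega> y z *s defect x + \<omega> x z *s defect y"
    if "x \<in> G 0" "y \<in> G 0" for x y z
    using defect_action[OF that, of z] rad' that by simp
  have defect_D: "defect (D x) = 0" if x: "x \<in> G 0" for x
  proof -
    \<comment> \<open>Since \<open>br (D x) a = br x (D a)\<close>, \<open>act\<close> describes one
      action on \<open>b\<close> in two ways. At \<open>x = a\<close> this makes
      \<open>defect (D a)\<close> its own negative.\<close>
    have *: "- defect (D x) = \<omega> x b *s defect (D a)" if x: "x \<in> G 0" for x
      using act[OF D_even[OF x] a, of b] act[OF x D_even[OF a], of b] qc[OF x, of a]
        rad[OF x] rad'[OF x] rad'[OF a] ab by simp
    have "defect (D a) = 0" using *[OF a] ab eq_minus_self by (metis scale_one)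
    then show ?thesis using *[OF x] by simp
  qed
  have D2: "D (br (D x) y) = br (D (D x)) y" if x: "x \<in> G 0" and y: "y \<in> G 0" for x y
  proof -
    have "2 *s br (defect (br (D x) y)) z = 0" for z
      using act[OF D_even[OF x] y, of z] rad'[OF x] defect_D[OF x] by simp
    then have "defect (br (D x) y) = 0" using trivial_centerD[OF center] by simp
    then have "2 *s D (br (D x) y) = 2 *s br (D (D x)) y"
      unfolding defect_br[OF D_even[OF x]] by (simp add: qc D_even x numeral_scale algebra_simps)
    then show ?thesis by (metis scale_cancel_left zero_neq_numeral)
  qed
  define e r c where "e = defect (br a b)" and "r = D e" and "c = br a b"
  have c: "c \<in> G 0" and e: "e \<in> G 0" using a b by (auto simp: c_def e_def intro: defect_even)
  have r: "r \<in> G 0" using e D_even r_def by blast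
  have rx: "br r x = D (D x) + D (D x)" if x: "x \<in> G 0" for x
  proof -
    have "2 *s br r x = 4 *s D (D x)"
      using act[OF a b, of "D x"] defect_D[OF x] rad a b ab qc[OF e, of x] by (simp add: r_def e_def)
    then have "2 *s br r x = 2 *s (D (D x) + D (D x))"
      by (simp add: numeral_scale algebra_simps)
    then show ?thesis by (metis scale_cancel_left zero_neq_numeral)
  qed
  have rad_r: "\<omega> x r = 0" if "x \<in> G 0" for x
    using rad[OF that] by (simp add: r_def)
  have xr: "br x r = - (D (D x) + D (D x))" if x: "x \<in> G 0" for x
    using rx[OF x] br_even_skew[OF r, of x] by simp
  \<comment> \<open>The Jacobi identity of \<open>x\<close>, \<open>y\<close> on \<open>r\<close>,
    with every action on \<open>r\<close> rewritten by \<open>xr\<close>.\<close>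
  have D2_br: "4 *s br x (D (D y)) = 2 *s D (D (br x y)) + \<omega> x y *s r"
    if x: "x \<in> G 0" and y: "y \<in> G 0" for x y
  proof -
    have xy: "br x y \<in> G 0" using x y by blast
    have "br y (D (D x)) = - br x (D (D y))"
      using qc[OF y, of "D x"] qc[OF x, of "D y"] br_even_skew[OF D_even[OF x], of "D y"] by simp
    then show ?thesis
      using jacobi_even[OF x y, of r] rad_r[OF x] rad_r[OF y]
      by (simp add: xr x y xy bilinear numeral_scale algebra_simps)
  qed
  define s where "s = D (D a)"
  have s: "s \<in> G 0" using a D_even s_def by blast
  have sb: "br a (D (D b)) = br s b"
    using qc[OF a] qc[OF D_even[OF a]] by (simp add: s_def)
  \<comment> \<open>Eliminate \<open>D (D c)\<close> between the definition of \<open>r\<close> and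
    \<open>D2_br\<close> at \<open>a\<close>, \<open>b\<close>.\<close>
  have r_eq: "br s b = r"
  proof -
    have "r = D (D c) + D (D c) - br s b - br s b"
      unfolding r_def e_def defect_br[OF a] using D2[OF a b]
      by (simp add: D_simps c_def s_def qc[OF a])
    moreover have "4 *s br s b = 2 *s D (D c) + r"
      using D2_br[OF a b] ab sb by (simp add: c_def)
    ultimately have "4 *s br s b = (r + br s b + br s b) + r"
      by (simp add: numeral_scale)
    then have "2 *s r = 2 *s br s b"
      by (simp add: numeral_scale algebra_simps)
    then show ?thesis by simp
  qed
  \<comment> \<open>The defect \<open>f\<close> kills the image of \<open>D\<close>, so
    \<open>D f\<close> is central. The computation of \<open>r_eq\<close> repeats with
    \<open>D f = 0\<close> in place of \<open>r\<close>.\<close>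
  have s_perp: "br y s = 0" if y: "y \<in> G 0" "\<omega> a y = 0" "\<omega> b y = 0" for y
  proof -
    define f where "f = defect (br a y)"
    have f: "f \<in> G 0" using a y by (auto simp: f_def intro: defect_even)
    have "2 *s br f (D x) = 0" for x
      using act[OF a y(1), of "D x"] y rad[OF a] rad[OF y(1)] by (simp add: f_def)
    then have "br (D f) x = 0" for x using qc[OF f] by simp
    then have "D f = 0" by (rule trivial_centerD[OF center])
    moreover have "D f = D (D (br a y)) + D (D (br a y)) - br s y - br s y"
      unfolding f_def defect_br[OF a] using D2[OF a y(1)]
      by (simp add: D_simps s_def qc[OF a])
    moreover have "4 *s br s y = 2 *s D (D (br a y))"
      using D2_br[OF a y(1)] y(2) qc[OF a, of "D y"] qc[OF D_even[OF a], of y] by (simp add: s_def)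
    ultimately have "2 *s br s y = 0"
      by (simp add: numeral_scale algebra_simps)
    then show ?thesis using br_even_skew[OF s, of y] by simp
  qed
  have a_s: "br a s = 0"
    using qc[OF a, of "D a"] br_even_self[OF D_even[OF a]] by (simp add: s_def)
  have b_s: "br b s = - r" using r_eq br_even_skew[OF s, of b] by simp
  obtain c' where c': "c' \<in> G 0" "\<omega> a c' = 0" "\<omega> b c' = 0"
    "c = \<omega> c b *s a + \<omega> a c *s b + c'"
    by (rule hyperbolic_decomp[OF a b ab c])
  have "br c s = 3 *s s"
    unfolding c_def jacobi_even[OF a b] using rad[OF a] rad[OF b]
    by (simp add: a_s b_s bilinear xr a ab s_def[symmetric] numeral_scale)
      (simp add: s_def rad a b)
  moreover have "br c s = - (\<omega> a c *s r)"
    by (subst c'(4)) (simp add: bilinear a_s b_s s_perp c'(1-3))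
  ultimately have s3: "3 *s s = - (\<omega> a c *s r)" by simp
  \<comment> \<open>Acting with \<open>a\<close> kills \<open>s\<close> and turns \<open>r\<close>
    into minus twice \<open>s\<close>; \<open>- s = s\<close> encodes that twice \<open>s\<close> is
    0.\<close>
  have "\<omega> a c = 0 \<or> - s = s"
    using arg_cong[OF s3, of "br a"] by (simp add: bilinear a_s xr a s_def[symmetric])
  then have "s = 0" using s3 eq_minus_self[of s] by auto
  then have "r = 0" using r_eq by simp
  then have DD: "D (D x) = 0" if "x \<in> G 0" for x
    using rx[OF that] by (metis add_self_eq_0 zero_simps(2))
  show ?thesis
    by (rule radical_valued_eq_0[OF lin a b ab qc rad]) (use D_even DD D2 in auto)
qed

end

section \<open>The case of a nonzero form\<close>

lemma G_eqI_linear: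
  assumes "Vector_Spaces.linear scale scale f" "Vector_Spaces.linear scale scale g"
    and "\<And>b x. x \<in> G b \<Longrightarrow> f x = g x"
  shows "f x = g x"
proof -
  obtain u v where x: "u \<in> G 0" "v \<in> G 1" "x = u + v" by (rule G_decomp)
  interpret f: module_hom scale scale f using assms(1) by (simp add: linear_iff_module_hom)
  interpret g: module_hom scale scale g using assms(2) by (simp add: linear_iff_module_hom)
  show ?thesis using assms(3)[OF x(1)] assms(3)[OF x(2)] by (simp add: x(3) f.add g.add)
qed

text \<open>Brackets of odd vectors are even, hence 0, so every vector is central.\<close>

lemma G0_trivial_imp_trivial:
  assumes center: "center = {0}" and G0: "G 0 = {0}"
  shows "(x::'g) = 0"
proof -
  have "br x y = 0" for x y
  proof -
    obtain u v where x: "u \<in> G 0" "v \<in> G 1" "x = u + v" by (rule G_decomp)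
    obtain u' v' where y: "u' \<in> G 0" "v' \<in> G 1" "y = u' + v'" by (rule G_decomp)
    have "br v v' = 0" using br_graded[OF x(2) y(2)] G0 by simp
    then show ?thesis using x y G0 by simp
  qed
  then show ?thesis by (rule trivial_centerD[OF center])
qed

lemma omega_nonzero_even:
  assumes center: "center = {0}" and nz: "\<omega> x y \<noteq> 0"
  obtains a b where "a \<in> G 0" "b \<in> G 0" "\<omega> a b = 1"
proof (cases "\<exists>a\<in>G 0. \<exists>b\<in>G 0. \<omega> a b \<noteq> 0")
  case True
  then obtain a b where "a \<in> G 0" "b \<in> G 0" "\<omega> a b \<noteq> 0" by blast
  then show ?thesis
    using that[of a "inverse (\<omega> a b) *s b"] G_closed(3) by (simp add: bilinear)
next
  case False
  \<comment> \<open>\<open>omega_odd_odd\<close> needs a nonzero even vector; without one the whole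
    space would be 0.\<close>
  have "y \<noteq> 0" using nz by auto
  then have "G 0 \<noteq> {0}" using G0_trivial_imp_trivial[OF center] by blast
  then obtain z where z: "z \<in> G 0" "z \<noteq> 0"
    using subspace_0[OF subspace_G] by blast
  obtain u v where x: "u \<in> G 0" "v \<in> G 1" "x = u + v" by (rule G_decomp)
  obtain u' v' where y: "u' \<in> G 0" "v' \<in> G 1" "y = u' + v'" by (rule G_decomp)
  have "\<omega> x y = 0"
    using False x y omega_odd_odd[OF x(2) y(2) z] omega_even_odd[OF x(1) y(2)]
      omega_odd_even[OF x(2) y(1)] by (simp add: bilinear)
  with nz show ?thesis by simp
qed

lemma qc_qder_eq_0:
  assumes center: "center = {0}" and nz: "\<omega> x0 y0 \<noteq> 0"
    and qd: "quasiderivation e d" and qc: "in_quasicentroid e d" and comp: "compatible e d"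
  shows "d t = 0"
proof -
  obtain a b where ab: "a \<in> G 0" "b \<in> G 0" "\<omega> a b = 1"
    using omega_nonzero_even[OF center nz] .
  have lin: "Vector_Spaces.linear scale scale d" and deg: "\<And>b x. x \<in> G b \<Longrightarrow> d x \<in> G (e + b)"
    using qc by (auto simp: in_quasicentroid_def homogeneous_map_def)
  have qc0: "br (d x) t = br x (d t)" if "x \<in> G 0" for x t
    using qc that unfolding in_quasicentroid_def by fastforce
  have comp0: "\<omega> (d x) t = - \<omega> x (d t)" if "x \<in> G 0" for x t
    using comp that unfolding compatible_def by (fastforce simp: eq_neg_iff_add_eq_0)
  show ?thesis
  proof (cases e)
    case zero
    obtain d' where d': "homogeneous_map e d'"
      "\<And>b x y. x \<in> G b \<Longrightarrow> d' (br x y) = br (d x) y + ksign (e * b) *s br x (d y)"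
      using qd by (auto simp: quasiderivation_def)
    show ?thesis
    proof (rule even_eq_0[of d d', OF lin _ _ _ qc0 _ comp0 center ab])
      show "Vector_Spaces.linear scale scale d'" using d' by (simp add: homogeneous_map_def)
      show "d x \<in> G 0" if "x \<in> G 0" for x using deg[OF that] zero by simp
      show "d' x \<in> G 0" if "x \<in> G 0" for x
        using d'(1) that zero unfolding homogeneous_map_def by (metis add_0)
      show "d' (br x t) = br x (d t) + br x (d t)" if "x \<in> G 0" for x t
        using d'(2)[OF that] qc0[OF that] by simp
    qed
  next
    case one
    have odd: "d x \<in> G 1" if "x \<in> G 0" for x using deg[OF that] one by simp
    \<comment> \<open>An odd \<open>d\<close> sends even vectors to odd ones, which pair to 0 with
      everything; compatibility moves this to the other argument.\<close>
    have "\<omega> (d x) t = 0" if "x \<in> G 0" for x t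
    proof -
      obtain z where z: "z \<in> G 0" "z \<noteq> 0" using ab by force
      obtain u v where t: "u \<in> G 0" "v \<in> G 1" "t = u + v" by (rule G_decomp)
      show ?thesis
        using omega_odd_odd[OF odd[OF that] t(2) z] omega_odd_even[OF odd[OF that] t(1)]
        by (simp add: t(3) bilinear)
    qed
    then have rad: "\<omega> x (d t) = 0" if "x \<in> G 0" for x t using comp0 that by simp
    show ?thesis
      by (rule radical_valued_eq_0[OF lin ab qc0 rad])
        (use omega_even_odd odd br_G0 in blast)+
  qed
qed

section \<open>The case of the zero form: Lie superalgebras\<close>

lemma centroid_lie:
  assumes center: "center = {0}" and \<omega>0: "\<And>x y. \<omega> x y = 0"
    and qd: "quasiderivation e d" and qc: "in_quasicentroid e d"
    and x: "x \<in> G b"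
  shows "br (d x) y = d (br x y)"
proof -
  obtain d' where d': "homogeneous_map e d'"
    "\<And>b x y. x \<in> G b \<Longrightarrow> d' (br x y) = br (d x) y + ksign (e * b) *s br x (d y)"
    using qd by (auto simp: quasiderivation_def)
  have lin: "Vector_Spaces.linear scale scale d" and deg: "\<And>b x. x \<in> G b \<Longrightarrow> d x \<in> G (e + b)"
    using qc by (auto simp: in_quasicentroid_def homogeneous_map_def)
  interpret D: module_hom scale scale d using lin by (simp add: linear_iff_module_hom)
  interpret D': module_hom scale scale d'
    using d'(1) by (simp add: homogeneous_map_def linear_iff_module_hom)
  have qc0: "br (d x) t = ksign (e * b) *s br x (d t)" if "x \<in> G b" for x t b
    using qc that unfolding in_quasicentroid_def by blast
  have qd0: "d' (br x t) = 2 *s br (d x) t" if "x \<in> G b" for x t b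
    using d'(2)[OF that, of t] qc0[OF that, of t] by (simp add: numeral_scale)
  \<comment> \<open>The super Jacobi identity in the form that bracketing with \<open>x\<close> is a
    superderivation.\<close>
  have leibniz: "br x (br y z) = br (br x y) z + ksign (b * c) *s br y (br x z)"
    if xyz: "x \<in> G b" "y \<in> G c" "z \<in> G f" for x y z b c f
  proof -
    define p q r :: 'k where "p = ksign (b * c)" and "q = ksign (c * f)" and "r = ksign (b * f)"
    have sq: "p * p = 1" "q * q = 1" "r * r = 1"
      unfolding p_def q_def r_def by (rule ksign_mult_self)+
    have 1: "br (br y z) x = - ((p * r) *s br x (br y z))"
      unfolding br_skew[OF br_graded[OF xyz(2,3)] xyz(1)] p_def r_def ksign_distrib
      by (simp only: mult.commute)
    have zx: "br z x = - (r *s br x z)"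
      unfolding br_skew[OF xyz(3,1)] r_def by (simp only: mult.commute)
    have xzy: "br (br x z) y = - ((p * q) *s br y (br x z))"
      unfolding br_skew[OF br_graded[OF xyz(1,3)] xyz(2)] p_def q_def ksign_distrib
      by (simp only: mult.commute)
    have "p *s br (br y z) x + q *s br (br z x) y + r *s br (br x y) z = 0"
      using omega_jacobi[OF xyz]
      unfolding \<omega>0 p_def q_def r_def
      by (simp only: scale_zero_left scale_zero_right add_0)
    then have "r *s (p *s (- ((p * r) *s br x (br y z)))
        + q *s (r *s (p * q) *s br y (br x z)) + r *s br (br x y) z) = 0"
      unfolding 1 zx by (simp add: bilinear xzy)
    then have "- ((r * (p * (p * r))) *s br x (br y z))
        + (r * (q * (r * (p * q)))) *s br y (br x z) + (r * r) *s br (br x y) z = 0"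
      by (simp only: scale_right_distrib scale_minus_right scale_scale)
    moreover have "p = 1 \<or> p = - 1" "q = 1 \<or> q = - 1" "r = 1 \<or> r = - 1"
      by (simp_all add: p_def q_def r_def ksign_def)
    then have "r * (p * (p * r)) = 1" "r * (q * (r * (p * q))) = p"
      by auto
    ultimately have "- br x (br y z) + p *s br y (br x z) + br (br x y) z = 0"
      by (simp only: sq(3) scale_one)
    then show ?thesis
      unfolding p_def[symmetric] by (simp add: algebra_simps)
  qed
  have *: "br (d x) y = d (br x y)" if y: "y \<in> G c" for y c
  proof -
    have "br (d (br x y) - br (d x) y) z = 0" if z: "z \<in> G f" for z f
    proof -
      define p q r :: 'k where "p = ksign (b * c)" and "q = ksign (e * b)" and "r = ksign (e * c)"
      have sq: "p * p = 1" "q * q = 1" "r * r = 1"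
        unfolding p_def q_def r_def by (rule ksign_mult_self)+
      \<comment> \<open>\<open>N\<close> and \<open>M\<close> are to be identified. The Leibniz
        rules with \<open>d\<close> applied to one of \<open>x\<close>, \<open>y\<close>,
        \<open>z\<close>, and the image of the plain rule under \<open>d'\<close>, relate them
        through \<open>X\<close>, \<open>Y\<close>, \<open>U\<close>, \<open>W\<close>.\<close>
      define N M where "N = br (br (d x) y) z" and "M = br (d (br x y)) z"
      define X where "X = br (d x) (br y z)"
      define Y where "Y = p *s br (d y) (br x z)"
      define U where "U = q *s br x (br (d y) z)"
      define W where "W = (r * p) *s br y (br (d x) z)"
      have dx: "br (d x) t = q *s br x (d t)" and dy: "br (d y) t = r *s br y (d t)" for t
        unfolding q_def r_def by (rule qc0[OF x] qc0[OF y])+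
      have dxy: "br (d (br x y)) t = (q * r) *s br (br x y) (d t)" for t
        using qc0[OF br_graded[OF x y], of t] unfolding q_def r_def ksign_distrib .
      have "X = N + W"
        using leibniz[OF deg[OF x] y z]
        unfolding X_def N_def W_def p_def r_def ksign_distrib .
      moreover have "br x (br (d y) z) = br (br x (d y)) z + (q * p) *s br (d y) (br x z)"
        using leibniz[OF x deg[OF y] z]
        unfolding p_def q_def ksign_distrib mult.commute[of b e] .
      then have "U = N + Y"
        unfolding U_def N_def Y_def dx
        by (simp add: bilinear sq scale_right_distrib flip: mult.assoc)
      moreover have "br x (br y z) = br (br x y) z + p *s br y (br x z)"
        using leibniz[OF x y z] unfolding p_def .
      then have "d' (br x (br y z)) = d' (br (br x y) z) + p *s d' (br y (br x z))"
        by (simp only: D'.add D'.scale)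
      then have "2 *s X = 2 *s (M + Y)"
        unfolding qd0[OF x] qd0[OF y] qd0[OF br_graded[OF x y]] X_def M_def Y_def
        by (simp add: scale_right_distrib mult.commute)
      then have "X = M + Y" by simp
      moreover have "br x (br y (d z)) = br (br x y) (d z) + p *s br y (br x (d z))"
        using leibniz[OF x y deg[OF z]] unfolding p_def .
      then have "U = M + W"
        unfolding U_def M_def W_def dxy dy dx
        by (simp only: bilinear scale_right_distrib scale_scale mult_ac)
      \<comment> \<open>Both sides are \<open>X + U\<close>.\<close>
      ultimately have "(M + Y) + (M + W) = (N + W) + (N + Y)" by metis
      then have "2 *s M = 2 *s N" by (simp add: numeral_scale algebra_simps)
      then have "M = N" by simp
      then show ?thesis by (simp add: M_def N_def bilinear)
    qed
    then have "br (d (br x y) - br (d x) y) z = 0" for z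
      by (rule_tac x = z in G_decomp) (simp add: br_right.add)
    then have "d (br x y) - br (d x) y = 0" by (rule trivial_centerD[OF center])
    then show ?thesis by simp
  qed
  obtain u v where y: "u \<in> G 0" "v \<in> G 1" "y = u + v" by (rule G_decomp)
  show ?thesis using *[OF y(1)] *[OF y(2)] by (simp add: y(3) bilinear D.add)
qed

lemma centroidI:
  assumes center: "center = {0}"
    and qd: "quasiderivation e d" and qc: "in_quasicentroid e d" and comp: "compatible e d"
  shows "in_centroid e d"
proof -
  have "br (d x) y = d (br x y)" if "x \<in> G b" for x y b
  proof (cases "\<forall>x y. \<omega> x y = 0")
    case True
    then show ?thesis using centroid_lie[OF center _ qd qc that] by blast
  next
    case False
    then show ?thesis using qc_qder_eq_0[OF center _ qd qc comp] by auto
  qed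
  then show ?thesis using qc by (auto simp: in_quasicentroid_def in_centroid_def)
qed

section \<open>Graded spans and the equality\<close>

interpretation maps: vector_space map_scale
  by (rule vector_space_map_scale)

lemma map_scale_apply: "map_scale c f x = c *s f x"
  by (simp add: map_scale_def)

lemma homogeneous_map_linear: "homogeneous_map a d \<Longrightarrow> Vector_Spaces.linear scale scale d"
  by (simp add: homogeneous_map_def)

lemma linear_zero_map: "Vector_Spaces.linear scale scale 0"
  by (simp add: linear_iff_module_hom module_hom_iff module_axioms)

lemma linear_add_map:
  assumes "Vector_Spaces.linear scale scale f" "Vector_Spaces.linear scale scale g"
  shows "Vector_Spaces.linear scale scale (f + g)"
  using assms by (simp add: linear_iff_module_hom module_hom_iff algebra_simps)

lemma linear_scale_map:
  assumes "Vector_Spaces.linear scale scale f"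
  shows "Vector_Spaces.linear scale scale (map_scale c f)"
  using assms by (simp add: linear_iff_module_hom module_hom_iff map_scale_apply algebra_simps)

lemma homogeneous_map_closed:
  "homogeneous_map a 0"
  "homogeneous_map a f \<Longrightarrow> homogeneous_map a g \<Longrightarrow> homogeneous_map a (f + g)"
  "homogeneous_map a f \<Longrightarrow> homogeneous_map a (map_scale c f)"
  using linear_zero_map linear_add_map linear_scale_map subspace_0[OF subspace_G] G_closed
  by (auto simp: homogeneous_map_def map_scale_apply)

lemma compatible_closed:
  "compatible a 0"
  "compatible a f \<Longrightarrow> compatible a g \<Longrightarrow> compatible a (f + g)"
  "compatible a f \<Longrightarrow> compatible a (map_scale c f)"
proof -
  show "compatible a 0" by (simp add: compatible_def)
  show "compatible a (f + g)" if "compatible a f" "compatible a g"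
    unfolding compatible_def
  proof (intro allI ballI)
    fix b x y assume x: "x \<in> G b"
    have "(\<omega> (f x) y + ksign (a * b) * \<omega> x (f y))
        + (\<omega> (g x) y + ksign (a * b) * \<omega> x (g y)) = 0"
      using that x unfolding compatible_def by auto
    then show "\<omega> ((f + g) x) y + ksign (a * b) * \<omega> x ((f + g) y) = 0"
      by (simp add: bilinear distrib_left add_ac)
  qed
  show "compatible a (map_scale c f)" if "compatible a f"
    unfolding compatible_def
  proof (intro allI ballI)
    fix b x y assume x: "x \<in> G b"
    have "c * (\<omega> (f x) y + ksign (a * b) * \<omega> x (f y)) = 0"
      using that x unfolding compatible_def by auto
    then show "\<omega> (map_scale c f x) y + ksign (a * b) * \<omega> x (map_scale c f y) = 0"
      by (simp only: map_scale_apply bilinear distrib_left mult.left_commute)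
  qed
qed

lemma quasicentroid_closed:
  "in_quasicentroid a 0"
  "in_quasicentroid a f \<Longrightarrow> in_quasicentroid a g \<Longrightarrow> in_quasicentroid a (f + g)"
  "in_quasicentroid a f \<Longrightarrow> in_quasicentroid a (map_scale c f)"
  unfolding in_quasicentroid_def
  by (simp_all add: homogeneous_map_closed bilinear map_scale_apply scale_right_distrib mult.commute)

lemma quasiderivation_closed:
  "quasiderivation a 0"
  "quasiderivation a f \<Longrightarrow> quasiderivation a g \<Longrightarrow> quasiderivation a (f + g)"
  "quasiderivation a f \<Longrightarrow> quasiderivation a (map_scale c f)"
proof -
  show "quasiderivation a 0"
    unfolding quasiderivation_def
    by (intro conjI exI[of _ 0] homogeneous_map_closed) simp
  show "quasiderivation a (f + g)" if fg: "quasiderivation a f" "quasiderivation a g"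
  proof -
    obtain f' g' where "homogeneous_map a f'" "homogeneous_map a g'"
      "\<And>b x y. x \<in> G b \<Longrightarrow> f' (br x y) = br (f x) y + ksign (a * b) *s br x (f y)"
      "\<And>b x y. x \<in> G b \<Longrightarrow> g' (br x y) = br (g x) y + ksign (a * b) *s br x (g y)"
      using fg unfolding quasiderivation_def by blast
    then show ?thesis
      using fg unfolding quasiderivation_def
      by (intro conjI exI[of _ "f' + g'"] homogeneous_map_closed)
        (auto simp: bilinear scale_right_distrib)
  qed
  show "quasiderivation a (map_scale c f)" if f: "quasiderivation a f"
  proof -
    obtain f' where "homogeneous_map a f'"
      "\<And>b x y. x \<in> G b \<Longrightarrow> f' (br x y) = br (f x) y + ksign (a * b) *s br x (f y)"
      using f unfolding quasiderivation_def by blast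
    then show ?thesis
      using f unfolding quasiderivation_def
      by (intro conjI exI[of _ "map_scale c f'"] homogeneous_map_closed)
        (auto simp: bilinear map_scale_apply scale_right_distrib mult.commute)
  qed
qed

text \<open>Members of one degree are closed under linear combinations, so one summand per degree
  suffices. The open predicate serves quasiderivations and the quasicentroid alike.\<close>

lemma span_graded:
  assumes closed: "\<And>a. P a 0" "\<And>a f g. P a f \<Longrightarrow> P a g \<Longrightarrow> P a (f + g)"
    "\<And>a f c. P a f \<Longrightarrow> P a (map_scale c f)"
    and f: "f \<in> maps.span {d. \<exists>a. P a d}"
  shows "\<exists>f0 f1. P (0 :: bit) f0 \<and> P 1 f1 \<and> f = f0 + f1"
  using f
proof (induction rule: maps.span_induct_alt)
  case base
  show ?case by (rule exI[of _ 0], rule exI[of _ 0]) (intro conjI closed(1) add_0[symmetric])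
next
  case (step c d g)
  then obtain e g0 g1 where e: "P e d" and g: "P 0 g0" "P 1 g1" "g = g0 + g1" by blast
  show ?case
  proof (cases e)
    case zero
    have "P 0 (map_scale c d + g0)" using e g closed zero by blast
    moreover have "map_scale c d + g = (map_scale c d + g0) + g1"
      by (simp only: g add.assoc)
    ultimately show ?thesis using g by blast
  next
    case one
    have "P 1 (map_scale c d + g1)" using e g closed one by blast
    moreover have "map_scale c d + g = g0 + (map_scale c d + g1)"
      by (simp only: g add.left_commute)
    ultimately show ?thesis using g by blast
  qed
qed

text \<open>On \<open>G b\<close> the difference \<open>f0 x - g0 x = g1 x - f1 x\<close> lies in
  both parts of the grading.\<close>

lemma homogeneous_sum_unique:
  assumes hom: "homogeneous_map 0 f0" "homogeneous_map 1 f1"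
    "homogeneous_map 0 g0" "homogeneous_map 1 g1"
    and eq: "f0 + f1 = g0 + g1"
  shows "f0 = g0 \<and> f1 = g1"
proof -
  have G_int: "z = 0" if "z \<in> G b" "z \<in> G (1 + b)" for z b
    using that G_inter by (cases b) auto
  have *: "f0 x = g0 x" if x: "x \<in> G b" for x b
  proof -
    have eqx: "f0 x - g0 x = g1 x - f1 x"
      using fun_cong[OF eq, of x] by (simp add: algebra_simps)
    have 0: "f0 x - g0 x \<in> G (0 + b)" and "g1 x - f1 x \<in> G (1 + b)"
      using hom x unfolding homogeneous_map_def by (blast intro: G_closed)+
    then have "f0 x - g0 x = 0"
      using G_int[OF 0[unfolded add_0]] unfolding eqx by blast
    then show ?thesis by simp
  qed
  have "f0 = g0"
    by (rule ext, rule G_eqI_linear[OF hom(1,3)[THEN homogeneous_map_linear]]) (rule *)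
  then show ?thesis using eq by simp
qed

lemma centroid_imp_quasicentroid: "in_centroid a d \<Longrightarrow> in_quasicentroid a d"
  by (auto simp: in_centroid_def in_quasicentroid_def)

text \<open>Both summands of the required identity equal \<open>d (br x y)\<close>, so twice
  \<open>d\<close> is a companion map.\<close>

lemma centroid_imp_quasiderivation:
  assumes "in_centroid a d"
  shows "quasiderivation a d"
  unfolding quasiderivation_def
proof (intro conjI exI[of _ "map_scale 2 d"] allI ballI)
  show "homogeneous_map a d" using assms by (simp add: in_centroid_def)
  then show "homogeneous_map a (map_scale 2 d)" by (rule homogeneous_map_closed)
  show "map_scale 2 d (br x y) = br (d x) y + ksign (a * b) *s br x (d y)" if "x \<in> G b" for b x y
    using assms that unfolding in_centroid_def by (metis map_scale_apply numeral_scale(1))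
qed

lemma centroid_eq_QDer_inter_QC:
  assumes center: "center = {0}"
  shows "C_omega = QDer_omega \<inter> QC_omega"
proof
  have "C_omega \<subseteq> QDer_omega" "C_omega \<subseteq> QC_omega"
    unfolding C_omega_def QDer_omega_def QC_omega_def
    by (intro maps.span_mono;
        use centroid_imp_quasicentroid centroid_imp_quasiderivation in blast)+
  then show "C_omega \<subseteq> QDer_omega \<inter> QC_omega" by blast
  show "QDer_omega \<inter> QC_omega \<subseteq> C_omega"
  proof
    fix f assume f: "f \<in> QDer_omega \<inter> QC_omega"
    obtain f0 f1 where q: "quasiderivation 0 f0 \<and> compatible 0 f0"
      "quasiderivation 1 f1 \<and> compatible 1 f1" "f = f0 + f1"
      using span_graded[of "\<lambda>a d. quasiderivation a d \<and> compatible a d" f] f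
        quasiderivation_closed compatible_closed unfolding QDer_omega_def by blast
    obtain g0 g1 where c: "in_quasicentroid 0 g0 \<and> compatible 0 g0"
      "in_quasicentroid 1 g1 \<and> compatible 1 g1" "f = g0 + g1"
      using span_graded[of "\<lambda>a d. in_quasicentroid a d \<and> compatible a d" f] f
        quasicentroid_closed compatible_closed unfolding QC_omega_def by blast
    \<comment> \<open>Identifying the two decompositions of \<open>f\<close> puts each component
      under the hypotheses of \<open>centroidI\<close>.\<close>
    have "f0 = g0 \<and> f1 = g1"
      by (rule homogeneous_sum_unique)
        (use q c in \<open>auto simp: quasiderivation_def in_quasicentroid_def\<close>)
    then have "in_centroid 0 f0" "in_centroid 1 f1"
      using centroidI[OF center] q c by blast+
    then show "f \<in> C_omega"
      unfolding C_omega_def q(3) using q by (intro maps.span_add maps.span_base) blast+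
  qed
qed

end

theorem theorem3p10:
  fixes scale :: "'k::field_char_0 \<Rightarrow> 'g::ab_group_add \<Rightarrow> 'g"
    and G :: "bit \<Rightarrow> 'g set"
    and br :: "'g \<Rightarrow> 'g \<Rightarrow> 'g"
    and \<omega> :: "'g \<Rightarrow> 'g \<Rightarrow> 'k"
  assumes "omega_lie_superalgebra scale G br \<omega>"
    and "omega_lie_superalgebra.center br = {0}"
  shows "omega_lie_superalgebra.C_omega scale G br \<omega> =
      omega_lie_superalgebra.QDer_omega scale G br \<omega> \<inter>
      omega_lie_superalgebra.QC_omega scale G br \<omega>"
  using omega_lie_superalgebra.centroid_eq_QDer_inter_QC[OF assms] .

end
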